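(* Let $\mathbf d=(d_0,d_1,\dots,d_L)$ with $d_i\ge2$ for $i=0,\dots,L-1$, and $\sigma(x)=1/x$. Then the dimension of the generic fiber of the combinatorial parameter map $\Psi_{\mathbf d,\sigma}$ is at least $$\sum_{i=1}^{L-1}d_i-1.$$
   Context: For weights $\mathbf w=(W_1,\dots,W_L)$, $W_k=(w_{k,i,j})\in\mathbb R^{d_k\times d_{k-1}}$, and $\mathbf x=(x_1,\dots,x_{d_0})$, define $p^{(1)}_{i}(\mathbf x):=\sum_{j=1}^{d_0}w_{1,i,j}x_j$, $q^{(0)}:=q^{(1)}:=1$, and for $k\ge1$ $$p^{(k+1)}_{i}:=\sum_{j=1}^{d_k}w_{k+1,i,j}\prod_{s\neq j}p^{(k)}_{s},\qquad q^{(k+1)}:=\prod_{j=1}^{d_k}p^{(k)}_{j}.$$ Let $P_{i,\mathbf w}:=p^{(L)}_i\,q^{(L-1)}q^{(L-3)}\cdots q^{(\delta(L+1))}$ ($1\le i\le d_L$) and $Q_{\mathbf w}:=q^{(L)}q^{(L-2)}\cdots q^{(\delta(L))}$, where $\delta(n)\in\{0,1\}$ is the parity of $n$ ($0$ if even, $1$ if odd). These are homogeneous in $\mathbf x$, of degrees denoted $n(\mathbf d)$ and $m(\mathbf d)$, and are the numerators and common denominator of the rational neural network $W_L\circ\sigma\circ\cdots\circ\sigma\circ W_1$ ($\sigma$ acting entrywise). The combinatorial parameter map is $$\Psi_{\mathbf d,\sigma}:\mathbb R^N\to(S^{n(\mathbf d)}(\mathbb R^{d_0}))^{d_L}\times S^{m(\mathbf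 d)}(\mathbb R^{d_0}),\quad\mathbf w\mapsto(P_{1,\mathbf w},\dots,P_{d_L,\mathbf w},Q_{\mathbf w}),$$ with $N=\sum_{i=0}^{L-1}d_id_{i+1}$ and $S^d(\mathbb R^n)$ the space of real homogeneous polynomials of degree $d$ in $n$ variables; common factors of the $P_{i,\mathbf w}$ and $Q_{\mathbf w}$ are not cancelled. The generic fiber is the fiber through a generic $\mathbf w\in\mathbb R^N$. *)

theory Defs
  imports "HOL-Analysis.Analysis" "HOL-Library.Poly_Mapping"
begin

section \<open>Weights and input polynomials\<close>

text \<open>
  A weight tuple \<open>(W_1, ..., W_L)\<close> is a function \<open>w\<close> with \<open>w (k, i, j) = w_{k,i,j}\<close>.
  The parameter space \<open>R^N\<close> consists of the extensional functions on \<open>weight_indices d L\<close>;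
  this set has \<open>N\<close> elements.
\<close>

type_synonym weights = "nat \<times> nat \<times> nat \<Rightarrow> real"

definition weight_indices :: "(nat \<Rightarrow> nat) \<Rightarrow> nat \<Rightarrow> (nat \<times> nat \<times> nat) set" where
  "weight_indices d L = {(k, i, j). k \<in> {1..L} \<and> i \<in> {1..d k} \<and> j \<in> {1..d (k - 1)}}"

lemma weight_indices_Sigma:
  "weight_indices d L = (SIGMA k:{1..L}. {1..d k} \<times> {1..d (k - 1)})"
  by (auto simp: weight_indices_def)

lemma card_weight_indices: "card (weight_indices d L) = (\<Sum>i<L. d i * d (Suc i))"
proof -
  have "card (weight_indices d L) = (\<Sum>k=1..L. d k * d (k - 1))"
    by (simp add: weight_indices_Sigma)
  also have "\<dots> = (\<Sum>i<L. d i * d (Suc i))"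
    by (rule sum.reindex_bij_witness[of _ Suc "\<lambda>k. k - 1"]) (auto simp: mult.commute)
  finally show ?thesis .
qed

text \<open>
  Formal real polynomials in \<open>x_1, x_2, ...\<close>, as finitely supported maps from monomials
  (exponent vectors) to coefficients; multiplication is convolution.
\<close>

type_synonym input_poly = "(nat \<Rightarrow>\<^sub>0 nat) \<Rightarrow>\<^sub>0 real"

definition Const :: "real \<Rightarrow> input_poly" where
  "Const c = Poly_Mapping.single 0 c"

definition Var :: "nat \<Rightarrow> input_poly" where
  "Var j = Poly_Mapping.single (Poly_Mapping.single j 1) 1"


section \<open>The combinatorial parameter map for the activation 1/x\<close>

text \<open>The value at layer \<open>0\<close> is a dummy; the recursion starts at layer \<open>1\<close>.\<close>

fun layer_p :: "(nat \<Rightarrow> nat) \<Rightarrow> weights \<Rightarrow> nat \<Rightarrow> nat \<Rightarrow> input_poly" where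
  "layer_p d w 0 i = 0"
| "layer_p d w (Suc 0) i = (\<Sum>j=1..d 0. Const (w (1, i, j)) * Var j)"
| "layer_p d w (Suc (Suc k)) i =
     (\<Sum>j=1..d (Suc k). Const (w (Suc (Suc k), i, j)) *
        (\<Prod>s\<in>{1..d (Suc k)} - {j}. layer_p d w (Suc k) s))"

definition layer_q :: "(nat \<Rightarrow> nat) \<Rightarrow> weights \<Rightarrow> nat \<Rightarrow> input_poly" where
  "layer_q d w k = (if k \<le> 1 then 1 else (\<Prod>j=1..d (k - 1). layer_p d w (k - 1) j))"

definition numer :: "(nat \<Rightarrow> nat) \<Rightarrow> nat \<Rightarrow> weights \<Rightarrow> nat \<Rightarrow> input_poly" where
  "numer d L w i =
     layer_p d w L i * (\<Prod>k\<in>{k. k \<le> L - 1 \<and> k mod 2 = (L + 1) mod 2}. layer_q d w k)"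

definition denom :: "(nat \<Rightarrow> nat) \<Rightarrow> nat \<Rightarrow> weights \<Rightarrow> input_poly" where
  "denom d L w = (\<Prod>k\<in>{k. k \<le> L \<and> k mod 2 = L mod 2}. layer_q d w k)"

definition parameter_map ::
    "(nat \<Rightarrow> nat) \<Rightarrow> nat \<Rightarrow> weights \<Rightarrow> (nat \<Rightarrow> input_poly) \<times> input_poly" where
  "parameter_map d L w = (restrict (numer d L w) {1..d L}, denom d L w)"


section \<open>The Zariski topology on a real affine space\<close>

definition affine_space :: "'v set \<Rightarrow> ('v \<Rightarrow> real) set" where
  "affine_space I = I \<rightarrow>\<^sub>E UNIV"

inductive poly_fun :: "'v set \<Rightarrow> (('v \<Rightarrow> real) \<Rightarrow> real) \<Rightarrow> bool" for I where
  const: "poly_fun I (\<lambda>x. c)"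
| coord: "v \<in> I \<Longrightarrow> poly_fun I (\<lambda>x. x v)"
| add: "poly_fun I f \<Longrightarrow> poly_fun I g \<Longrightarrow> poly_fun I (\<lambda>x. f x + g x)"
| mult: "poly_fun I f \<Longrightarrow> poly_fun I g \<Longrightarrow> poly_fun I (\<lambda>x. f x * g x)"

definition zero_locus :: "'v set \<Rightarrow> (('v \<Rightarrow> real) \<Rightarrow> real) set \<Rightarrow> ('v \<Rightarrow> real) set" where
  "zero_locus I F = {x \<in> affine_space I. \<forall>f\<in>F. f x = 0}"

definition algebraic_set :: "'v set \<Rightarrow> ('v \<Rightarrow> real) set \<Rightarrow> bool" where
  "algebraic_set I Z \<longleftrightarrow> (\<exists>F. (\<forall>f\<in>F. poly_fun I f) \<and> Z = zero_locus I F)"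

definition zariski :: "'v set \<Rightarrow> ('v \<Rightarrow> real) topology" where
  "zariski I = topology (\<lambda>U. U \<subseteq> affine_space I \<and> algebraic_set I (affine_space I - U))"

lemma algebraic_set_empty: "algebraic_set I {}"
  unfolding algebraic_set_def zero_locus_def
  by (rule exI[of _ "{\<lambda>x. 1}"]) (auto intro: poly_fun.const)

lemma algebraic_set_Un:
  assumes "algebraic_set I Y" "algebraic_set I Z"
  shows "algebraic_set I (Y \<union> Z)"
proof -
  obtain F G where F: "\<forall>f\<in>F. poly_fun I f" "Y = zero_locus I F"
    and G: "\<forall>g\<in>G. poly_fun I g" "Z = zero_locus I G"
    using assms unfolding algebraic_set_def by blast
  define H where "H = {\<lambda>x. f x * g x | f g. f \<in> F \<and> g \<in> G}"
  have "\<forall>h\<in>H. poly_fun I h"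
    using F(1) G(1) by (auto simp: H_def intro: poly_fun.mult)
  moreover have "Y \<union> Z = zero_locus I H"
  proof (intro equalityI subsetI)
    fix x assume "x \<in> Y \<union> Z"
    then have "x \<in> zero_locus I F \<or> x \<in> zero_locus I G"
      by (simp only: F(2) G(2) Un_iff)
    then show "x \<in> zero_locus I H"
      by (auto simp: H_def zero_locus_def)
  next
    fix x assume x: "x \<in> zero_locus I H"
    show "x \<in> Y \<union> Z"
    proof (rule ccontr)
      assume "x \<notin> Y \<union> Z"
      then have "x \<notin> zero_locus I F" "x \<notin> zero_locus I G"
        using F(2) G(2) by blast+
      with x obtain f g where fg: "f \<in> F" "g \<in> G" "f x \<noteq> 0" "g x \<noteq> 0"
        by (auto simp: zero_locus_def)
      then have "(\<lambda>x. f x * g x) \<in> H" by (auto simp: H_def)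
      with x have "f x * g x = 0" by (auto simp: zero_locus_def)
      with fg show False by simp
    qed
  qed
  ultimately show ?thesis unfolding algebraic_set_def by blast
qed

lemma algebraic_set_Inter:
  assumes "\<And>Z. Z \<in> K \<Longrightarrow> algebraic_set I Z"
  shows "algebraic_set I (affine_space I \<inter> \<Inter>K)"
proof -
  obtain F where F: "\<And>Z. Z \<in> K \<Longrightarrow> (\<forall>f\<in>F Z. poly_fun I f) \<and> Z = zero_locus I (F Z)"
    using assms unfolding algebraic_set_def by metis
  have "affine_space I \<inter> \<Inter>K = zero_locus I (\<Union>Z\<in>K. F Z)"
  proof (intro equalityI subsetI)
    fix x assume x: "x \<in> affine_space I \<inter> \<Inter>K"
    have "f x = 0" if "Z \<in> K" "f \<in> F Z" for Z f
    proof -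
      have "x \<in> zero_locus I (F Z)" using x F[OF \<open>Z \<in> K\<close>] \<open>Z \<in> K\<close> by blast
      then show ?thesis using \<open>f \<in> F Z\<close> by (simp add: zero_locus_def)
    qed
    then show "x \<in> zero_locus I (\<Union>Z\<in>K. F Z)" using x by (auto simp: zero_locus_def)
  next
    fix x assume x: "x \<in> zero_locus I (\<Union>Z\<in>K. F Z)"
    have "x \<in> Z" if "Z \<in> K" for Z
    proof -
      have "x \<in> zero_locus I (F Z)" using x that by (auto simp: zero_locus_def)
      then show ?thesis using F[OF that] by blast
    qed
    then show "x \<in> affine_space I \<inter> \<Inter>K" using x by (auto simp: zero_locus_def)
  qed
  moreover have "\<forall>f\<in>(\<Union>Z\<in>K. F Z). poly_fun I f"
    using F by blast
  ultimately show ?thesis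
    unfolding algebraic_set_def by blast
qed

lemma istopology_zariski:
  "istopology (\<lambda>U. U \<subseteq> affine_space I \<and> algebraic_set I (affine_space I - U))"
  unfolding istopology_def
proof (intro conjI allI impI)
  fix S T
  assume "S \<subseteq> affine_space I \<and> algebraic_set I (affine_space I - S)"
    and "T \<subseteq> affine_space I \<and> algebraic_set I (affine_space I - T)"
  then show "algebraic_set I (affine_space I - S \<inter> T)"
    using algebraic_set_Un[of I "affine_space I - S" "affine_space I - T"]
    by (simp add: Diff_Int)
next
  fix K
  assume K: "\<forall>U\<in>K. U \<subseteq> affine_space I \<and> algebraic_set I (affine_space I - U)"
  have "affine_space I - \<Union>K = affine_space I \<inter> \<Inter>((\<lambda>U. affine_space I - U) ` K)"
    by auto
  moreover have "algebraic_set I Z" if "Z \<in> (\<lambda>U. affine_space I - U) ` K" for Z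
    using that K by blast
  ultimately show "algebraic_set I (affine_space I - \<Union>K)"
    by (simp only: algebraic_set_Inter)
  show "\<Union>K \<subseteq> affine_space I" using K by blast
qed blast

lemma openin_zariski:
  "openin (zariski I) U \<longleftrightarrow> U \<subseteq> affine_space I \<and> algebraic_set I (affine_space I - U)"
  unfolding zariski_def by (simp add: topology_inverse'[OF istopology_zariski])

lemma topspace_zariski: "topspace (zariski I) = affine_space I"
proof
  show "topspace (zariski I) \<subseteq> affine_space I"
    by (auto simp: topspace_def openin_zariski)
  show "affine_space I \<subseteq> topspace (zariski I)"
    by (rule openin_subset) (simp add: openin_zariski algebraic_set_empty)
qed

lemma closedin_zariski: "closedin (zariski I) Z \<longleftrightarrow> algebraic_set I Z"
proof -
  have sub: "Z \<subseteq> affine_space I" if "algebraic_set I Z"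
    using that by (auto simp: algebraic_set_def zero_locus_def)
  have "closedin (zariski I) Z \<longleftrightarrow>
      Z \<subseteq> affine_space I \<and> algebraic_set I (affine_space I - (affine_space I - Z))"
    by (simp add: closedin_def topspace_zariski openin_zariski)
  also have "\<dots> \<longleftrightarrow> Z \<subseteq> affine_space I \<and> algebraic_set I Z"
    by (intro conj_cong refl) (simp add: Diff_Diff_Int Int_absorb1)
  finally show ?thesis using sub by blast
qed

text \<open>A nonempty Zariski open subset of the (irreducible) real affine space is dense.\<close>

definition for_generic :: "'v set \<Rightarrow> (('v \<Rightarrow> real) \<Rightarrow> bool) \<Rightarrow> bool" where
  "for_generic I P \<longleftrightarrow> (\<exists>U. openin (zariski I) U \<and> U \<noteq> {} \<and> (\<forall>x\<in>U. P x))"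


section \<open>Dimension\<close>

definition irreducible_space :: "'a topology \<Rightarrow> bool" where
  "irreducible_space X \<longleftrightarrow> topspace X \<noteq> {} \<and>
     (\<forall>A B. closedin X A \<and> closedin X B \<and> A \<union> B = topspace X \<longrightarrow>
        A = topspace X \<or> B = topspace X)"

text \<open>
  Krull dimension: the supremum of the lengths \<open>n\<close> of chains \<open>Z_0 < ... < Z_n\<close> of irreducible
  closed subsets. The empty space has dimension \<open>-\<infinity>\<close>. For a real algebraic set
  with its Zariski topology this is the usual dimension of the set of real points.
\<close>

definition krull_dim :: "'a topology \<Rightarrow> ereal" where
  "krull_dim X = (SUP n \<in> {n. \<exists>Z.
      (\<forall>i\<le>n. closedin X (Z i) \<and> irreducible_space (subtopology X (Z i))) \<and>
      (\<forall>i<n. Z i \<subset> Z (Suc i))}. ereal (real n))"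


section \<open>Fibers of the parameter map\<close>

definition fiber :: "(nat \<Rightarrow> nat) \<Rightarrow> nat \<Rightarrow> weights \<Rightarrow> weights set" where
  "fiber d L w =
     {v \<in> affine_space (weight_indices d L). parameter_map d L v = parameter_map d L w}"

definition fiber_dim :: "(nat \<Rightarrow> nat) \<Rightarrow> nat \<Rightarrow> weights \<Rightarrow> ereal" where
  "fiber_dim d L w = krull_dim (subtopology (zariski (weight_indices d L)) (fiber d L w))"

end

theory Submission
  imports Defs "HOL-Complex_Analysis.Conformal_Mappings"
begin

text \<open>
  The neurons of the hidden layers can be rescaled. Multiplying \<open>layer_p d w k i\<close> by
  \<open>\<mu> k i > 0\<close> multiplies the product over \<open>s \<noteq> j\<close> that enters layer \<open>k + 1\<close> by
  \<open>M k / \<mu> k j\<close>, where \<open>M k\<close> is the product of the scales of layer \<open>k\<close>, and a change of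
  \<open>w (k + 1, i, j)\<close> absorbs this factor. The common denominator then only picks up the factor
  \<open>M (L - 1) * M (L - 3) * ...\<close> and every numerator the factor
  \<open>\<mu> L i * M (L - 2) * M (L - 4) * ...\<close>. The second one becomes 1 by the choice of \<open>\<mu> L i\<close>,
  the first one imposes a single equation on the scales of the hidden neurons. So there are
  as many free scales as hidden neurons, minus one, and each choice gives a point of the fiber
  (lemma \<open>rescaled_in_fiber\<close>).

  If no weight vanishes, the scales can be read off from the rescaled weights, even by
  polynomials (lemma \<open>recovered_scale_rescaled\<close>): the quotient of the new and the old value of
  \<open>w (k + 1, i, 1)\<close> is \<open>\<mu> (k + 1) i * \<mu> k 1 / M k\<close>, and \<open>M k / \<mu> k 1\<close> is
  a product of scales of layer \<open>k\<close>, so no division by a scale ever occurs.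

  Setting more and more of the free scales to arbitrary positive values while the other free ones stay 1
  produces subsets of the fiber whose Zariski closures form the required chain
  (lemma \<open>krull_dim_ge_card\<close>). The inclusions are strict because the polynomial that
  recovers a scale is constantly 1 before this scale is released, and not afterwards. For
  irreducibility, write the scales as exponentials of real parameters: a polynomial in the
  rescaled weights becomes an exponential polynomial, and by the identity theorem such functions
  have no zero divisors (lemma \<open>line_entire_no_zero_divisors\<close>).
\<close>

section \<open>Functions that are entire along lines\<close>

text \<open>
  Two points of the parameter space lie on a common line, so the identity theorem in one complex
  variable suffices, and the parameters may be functions on any type without a topology.
\<close>

definition line_entire :: "(('h \<Rightarrow> real) \<Rightarrow> real) \<Rightarrow> bool" where
  "line_entire f \<longleftrightarrow> (\<forall>u v. \<exists>F. F holomorphic_on UNIV \<and>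
     (\<forall>s. F (complex_of_real s) = complex_of_real (f (\<lambda>h. u h + s * (v h - u h)))))"

lemma line_entireE:
  assumes "line_entire f"
  obtains F where "F holomorphic_on UNIV"
    "\<And>s. F (complex_of_real s) = complex_of_real (f (\<lambda>h. u h + s * (v h - u h)))"
  using assms unfolding line_entire_def by blast

lemma line_entire_const: "line_entire (\<lambda>u. c)"
  unfolding line_entire_def by (auto intro!: exI[of _ "\<lambda>z. complex_of_real c"])

lemma line_entire_coord: "line_entire (\<lambda>u. u h)"
  unfolding line_entire_def
proof (intro allI)
  fix u v :: "'a \<Rightarrow> real"
  show "\<exists>F. F holomorphic_on UNIV \<and>
      (\<forall>s. F (complex_of_real s) = complex_of_real (u h + s * (v h - u h)))"
    by (rule exI[of _ "\<lambda>z. of_real (u h) + z * of_real (v h - u h)"])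
      (auto intro!: holomorphic_intros)
qed

lemma line_entire_add:
  assumes "line_entire f" "line_entire g"
  shows "line_entire (\<lambda>u. f u + g u)"
  unfolding line_entire_def
proof (intro allI)
  fix u v
  obtain F where F: "F holomorphic_on UNIV"
    "\<And>s. F (complex_of_real s) = complex_of_real (f (\<lambda>h. u h + s * (v h - u h)))"
    by (rule line_entireE[OF assms(1), where u = u and v = v]) blast
  obtain G where "G holomorphic_on UNIV"
    "\<And>s. G (complex_of_real s) = complex_of_real (g (\<lambda>h. u h + s * (v h - u h)))"
    by (rule line_entireE[OF assms(2), where u = u and v = v]) blast
  with F show "\<exists>F. F holomorphic_on UNIV \<and> (\<forall>s. F (complex_of_real s) =
      complex_of_real (f (\<lambda>h. u h + s * (v h - u h)) + g (\<lambda>h. u h + s * (v h - u h))))"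
    by (intro exI[of _ "\<lambda>z. F z + G z"]) (auto intro!: holomorphic_intros)
qed

lemma line_entire_mult:
  assumes "line_entire f" "line_entire g"
  shows "line_entire (\<lambda>u. f u * g u)"
  unfolding line_entire_def
proof (intro allI)
  fix u v
  obtain F where F: "F holomorphic_on UNIV"
    "\<And>s. F (complex_of_real s) = complex_of_real (f (\<lambda>h. u h + s * (v h - u h)))"
    by (rule line_entireE[OF assms(1), where u = u and v = v]) blast
  obtain G where "G holomorphic_on UNIV"
    "\<And>s. G (complex_of_real s) = complex_of_real (g (\<lambda>h. u h + s * (v h - u h)))"
    by (rule line_entireE[OF assms(2), where u = u and v = v]) blast
  with F show "\<exists>F. F holomorphic_on UNIV \<and> (\<forall>s. F (complex_of_real s) =
      complex_of_real (f (\<lambda>h. u h + s * (v h - u h)) * g (\<lambda>h. u h + s * (v h - u h))))"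
    by (intro exI[of _ "\<lambda>z. F z * G z"]) (auto intro!: holomorphic_intros)
qed

lemma line_entire_exp:
  assumes "line_entire f"
  shows "line_entire (\<lambda>u. exp (f u))"
  unfolding line_entire_def
proof (intro allI)
  fix u v
  obtain F where "F holomorphic_on UNIV"
    "\<And>s. F (complex_of_real s) = complex_of_real (f (\<lambda>h. u h + s * (v h - u h)))"
    by (rule line_entireE[OF assms, where u = u and v = v]) blast
  then show "\<exists>F. F holomorphic_on UNIV \<and> (\<forall>s. F (complex_of_real s) =
      complex_of_real (exp (f (\<lambda>h. u h + s * (v h - u h)))))"
    by (intro exI[of _ "\<lambda>z. exp (F z)"]) (auto intro!: holomorphic_intros simp: exp_of_real)
qed

lemma line_entire_minus:
  assumes "line_entire f"
  shows "line_entire (\<lambda>u. - f u)"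
  using line_entire_mult[OF line_entire_const[of "-1"] assms] by simp

lemma line_entire_diff:
  assumes "line_entire f" "line_entire g"
  shows "line_entire (\<lambda>u. f u - g u)"
  using line_entire_add[OF assms(1) line_entire_minus[OF assms(2)]] by simp

lemma line_entire_sum:
  assumes "\<And>a. a \<in> A \<Longrightarrow> line_entire (f a)"
  shows "line_entire (\<lambda>u. \<Sum>a\<in>A. f a u)"
  using assms
  by (induction A rule: infinite_finite_induct) (auto intro: line_entire_const line_entire_add)

lemma line_entire_if:
  assumes "line_entire f" "line_entire g"
  shows "line_entire (\<lambda>u. if b then f u else g u)"
  using assms by (cases b) auto

lemma line_entire_poly_fun:
  assumes "poly_fun I f" "\<And>v. v \<in> I \<Longrightarrow> line_entire (\<lambda>u. \<phi> u v)"
  shows "line_entire (\<lambda>u. f (\<phi> u))"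
  using assms by induction (auto intro: line_entire_const line_entire_add line_entire_mult)

text \<open>
  If neither factor vanishes on the flat \<open>T\<close>, join a point where \<open>f\<close> is nonzero to a point where
  \<open>g\<close> is nonzero. Near the first point \<open>f\<close> has no zeros, so \<open>g\<close> vanishes on a segment of the
  line and, by the identity theorem, on all of it, the second point included.
\<close>

lemma line_entire_no_zero_divisors:
  assumes f: "line_entire f" and g: "line_entire g"
    and flat: "\<And>u v s. u \<in> T \<Longrightarrow> v \<in> T \<Longrightarrow> (\<lambda>h. u h + s * (v h - u h)) \<in> T"
    and prod: "\<And>u. u \<in> T \<Longrightarrow> f u * g u = 0"
  shows "(\<forall>u\<in>T. f u = 0) \<or> (\<forall>u\<in>T. g u = 0)"
proof (rule ccontr)
  assume "\<not> ?thesis"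
  then obtain u v where u: "u \<in> T" "f u \<noteq> 0" and v: "v \<in> T" "g v \<noteq> 0" by blast
  obtain F where F: "F holomorphic_on UNIV"
    "\<And>s. F (complex_of_real s) = complex_of_real (f (\<lambda>h. u h + s * (v h - u h)))"
    by (rule line_entireE[OF f, where u = u and v = v]) blast
  obtain G where G: "G holomorphic_on UNIV"
    "\<And>s. G (complex_of_real s) = complex_of_real (g (\<lambda>h. u h + s * (v h - u h)))"
    by (rule line_entireE[OF g, where u = u and v = v]) blast
  have FG: "F (of_real s) * G (of_real s) = 0" for s
    using prod[OF flat[OF u(1) v(1), of s]] by (auto simp: F(2) G(2))
  have F0: "F 0 \<noteq> 0" using F(2)[of 0] u(2) by simp
  have G1: "G 1 \<noteq> 0" using G(2)[of 1] v(2) by simp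
  have "isCont F 0"
    using holomorphic_on_imp_continuous_on[OF F(1)]
    by (simp add: continuous_on_eq_continuous_at)
  then have "\<forall>\<^sub>F z in nhds 0. F z \<noteq> 0"
    using F0 by (auto simp: isCont_def tendsto_at_iff_tendsto_nhds intro: tendsto_imp_eventually_ne)
  then obtain e where e: "e > 0" "\<And>z. dist z 0 < e \<Longrightarrow> F z \<noteq> 0"
    by (auto simp: eventually_nhds_metric)
  define S where "S = complex_of_real ` {s. \<bar>s\<bar> < e}"
  have "0 islimpt S"
    unfolding islimpt_approachable
  proof (intro allI impI)
    fix r :: real assume "r > 0"
    moreover have "complex_of_real (min e r / 2) \<in> S"
      unfolding S_def using \<open>r > 0\<close> e(1) by (intro imageI) auto
    ultimately show "\<exists>z\<in>S. z \<noteq> 0 \<and> dist z 0 < r"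
      using e(1) by (intro bexI[of _ "complex_of_real (min e r / 2)"]) auto
  qed
  moreover have "G z = 0" if "z \<in> S" for z
  proof -
    obtain x where "z = complex_of_real x" "\<bar>x\<bar> < e" using \<open>z \<in> S\<close> by (auto simp: S_def)
    then show ?thesis using e(2)[of z] FG[of x] by simp
  qed
  ultimately have "G 1 = 0"
    by (intro analytic_continuation[OF G(1), of S 0 1]) auto
  with G1 show False by simp
qed


section \<open>A lower bound for the Krull dimension\<close>

text \<open>
  The set \<open>X\<close> contains the image of a real parameter space of dimension \<open>card H\<close>, and the
  polynomials \<open>g h\<close> detect on this image which parameters are zero. The chain consists of the
  closures in \<open>X\<close> of the images of the coordinate subspaces of dimensions \<open>0, 1, ..., card H\<close>.
  Such a closure is irreducible: if it were the union of two smaller closed sets, each of them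
  would lie in the zero set of a polynomial that is not identically zero on the image, although
  the product of the two polynomials is.
\<close>

lemma krull_dim_ge_card:
  fixes \<phi> :: "('h \<Rightarrow> real) \<Rightarrow> 'v \<Rightarrow> real"
  assumes "finite H"
    and X: "X \<subseteq> affine_space I" "\<And>u. \<phi> u \<in> X"
    and entire: "\<And>v. v \<in> I \<Longrightarrow> line_entire (\<lambda>u. \<phi> u v)"
    and g: "\<And>h. h \<in> H \<Longrightarrow> poly_fun I (g h)"
      "\<And>h u. h \<in> H \<Longrightarrow> g h (\<phi> u) = 0 \<longleftrightarrow> u h = 0"
  shows "ereal (real (card H)) \<le> krull_dim (subtopology (zariski I) X)"
proof -
  define n where "n = card H"
  obtain e where e: "bij_betw e {..<n} H"
    using ex_bij_betw_nat_finite[OF \<open>finite H\<close>] by (auto simp: n_def atLeast0LessThan)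
  define T :: "nat \<Rightarrow> ('h \<Rightarrow> real) set" where "T j = {u. \<forall>h. h \<notin> e ` {..<j} \<longrightarrow> u h = 0}" for j
  (* The closure of the image of \<open>T j\<close> is the zero locus of the polynomials vanishing on it. *)
  define V where "V j = {f. poly_fun I f \<and> (\<forall>u\<in>T j. f (\<phi> u) = 0)}" for j
  define Z where "Z j = zero_locus I (V j) \<inter> X" for j
  have \<phi>Z: "\<phi> u \<in> Z j" if "u \<in> T j" for u j
    using that X by (auto simp: Z_def V_def zero_locus_def)
  have vanish: "f x = 0" if "poly_fun I f" "\<forall>u\<in>T j. f (\<phi> u) = 0" "x \<in> Z j" for f x j
    using that by (auto simp: Z_def V_def zero_locus_def)
  have closed: "closedin (subtopology (zariski I) X) (Z j)" for j
  proof -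
    have "\<forall>f\<in>V j. poly_fun I f" by (auto simp: V_def)
    then have "algebraic_set I (zero_locus I (V j))" unfolding algebraic_set_def by blast
    then show ?thesis unfolding closedin_subtopology closedin_zariski Z_def by blast
  qed
  have flat: "(\<lambda>h. u h + s * (v h - u h)) \<in> T j" if "u \<in> T j" "v \<in> T j" for u v s j
    using that by (auto simp: T_def)
  have irred: "irreducible_space (subtopology (subtopology (zariski I) X) (Z j))" for j
  proof -
    have ZX: "Z j \<subseteq> X" "Z j \<subseteq> affine_space I" using X(1) by (auto simp: Z_def)
    have top: "subtopology (subtopology (zariski I) X) (Z j) = subtopology (zariski I) (Z j)"
      using ZX by (simp add: subtopology_subtopology Int_absorb1)
    have topsp: "topspace (subtopology (zariski I) (Z j)) = Z j"
      using ZX by (simp add: topspace_zariski Int_absorb1)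
    have dense: "A = Z j" if "A = zero_locus I F \<inter> Z j" "\<forall>f\<in>F. \<forall>u\<in>T j. f (\<phi> u) = 0"
      "\<forall>f\<in>F. poly_fun I f" for A F
      using that ZX vanish by (auto simp: zero_locus_def)
    show ?thesis
      unfolding top irreducible_space_def topsp
    proof (intro conjI allI impI)
      show "Z j \<noteq> {}" using \<phi>Z[of "\<lambda>_. 0" j] by (auto simp: T_def)
    next
      fix A B
      assume "closedin (subtopology (zariski I) (Z j)) A \<and>
        closedin (subtopology (zariski I) (Z j)) B \<and> A \<union> B = Z j"
      then obtain FA FB where
        A: "A = zero_locus I FA \<inter> Z j" "\<forall>f\<in>FA. poly_fun I f" and
        B: "B = zero_locus I FB \<inter> Z j" "\<forall>f\<in>FB. poly_fun I f" and
        AB: "A \<union> B = Z j"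
        unfolding closedin_subtopology closedin_zariski algebraic_set_def by blast
      show "A = Z j \<or> B = Z j"
      proof (rule ccontr)
        assume "\<not> ?thesis"
        then obtain a b where a: "a \<in> FA" "\<not> (\<forall>u\<in>T j. a (\<phi> u) = 0)"
          and b: "b \<in> FB" "\<not> (\<forall>u\<in>T j. b (\<phi> u) = 0)"
          using dense[OF A(1) _ A(2)] dense[OF B(1) _ B(2)] by blast
        have ab: "a (\<phi> u) * b (\<phi> u) = 0" if "u \<in> T j" for u
        proof -
          have "\<phi> u \<in> A \<union> B" using \<phi>Z[OF that] AB by simp
          then show ?thesis using A(1) B(1) a(1) b(1) by (auto simp: zero_locus_def)
        qed
        have a_poly: "poly_fun I a" and b_poly: "poly_fun I b"
          using A(2) B(2) a(1) b(1) by auto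
        show False
          using line_entire_no_zero_divisors[of "\<lambda>u. a (\<phi> u)" "\<lambda>u. b (\<phi> u)" "T j",
              OF line_entire_poly_fun[of I a \<phi>, OF a_poly entire]
                line_entire_poly_fun[of I b \<phi>, OF b_poly entire] flat ab] a(2) b(2)
          by blast
      qed
    qed
  qed
  have strict: "Z j \<subset> Z (Suc j)" if "j < n" for j
  proof (rule psubsetI)
    have "T j \<subseteq> T (Suc j)" by (auto simp: T_def lessThan_Suc)
    then show "Z j \<subseteq> Z (Suc j)" by (auto simp: Z_def V_def zero_locus_def)
    have H: "e j \<in> H" using e that by (auto simp: bij_betw_def)
    have "e j \<notin> e ` {..<j}"
      using e that inj_on_contraD[of e "{..<n}" j] by (fastforce simp: bij_betw_def)
    then have "g (e j) x = 0" if "x \<in> Z j" for x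
      using vanish[OF g(1)[OF H] _ that] g(2)[OF H] by (auto simp: T_def)
    moreover have "\<phi> (\<lambda>h. if h = e j then 1 else 0) \<in> Z (Suc j)"
      by (rule \<phi>Z) (auto simp: T_def)
    moreover have "g (e j) (\<phi> (\<lambda>h. if h = e j then 1 else 0)) \<noteq> 0"
      using g(2)[OF H] by simp
    ultimately show "Z j \<noteq> Z (Suc j)" by blast
  qed
  have "n \<in> {n. \<exists>Z. (\<forall>i\<le>n. closedin (subtopology (zariski I) X) (Z i) \<and>
      irreducible_space (subtopology (subtopology (zariski I) X) (Z i))) \<and>
      (\<forall>i<n. Z i \<subset> Z (Suc i))}"
    using closed irred strict by blast
  then show ?thesis
    unfolding krull_dim_def n_def[symmetric] by (rule SUP_upper)
qed


section \<open>Rescaling of the neurons\<close>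

lemma Const_mult: "Const (a * b) = Const a * Const b"
  by (simp add: Const_def mult_single)

lemma Const_1: "Const 1 = 1"
  by (simp add: Const_def)

lemma Const_prod: "Const (\<Prod>a\<in>A. f a) = (\<Prod>a\<in>A. Const (f a))"
  by (induction A rule: infinite_finite_induct) (simp_all add: Const_1 Const_mult)

text \<open>
  The number \<open>t k i\<close> is the logarithm of the scale of the neuron \<open>i\<close> in layer \<open>k\<close>. The inputs
  are never rescaled: \<open>t 0\<close> is assumed to be zero below, which makes the first layer an instance
  of the general formula and gives \<open>layer_q\<close> the factor 1 at the indices 0 and 1.
\<close>

definition rescaled :: "(nat \<Rightarrow> nat) \<Rightarrow> nat \<Rightarrow> (nat \<Rightarrow> nat \<Rightarrow> real) \<Rightarrow> weights \<Rightarrow> weights" where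
  "rescaled d L t w = (\<lambda>(k, i, j)\<in>weight_indices d L.
     w (k, i, j) * exp (t k i + t (k - 1) j - (\<Sum>s=1..d (k - 1). t (k - 1) s)))"

text \<open>
  In the recursion the scales of the neurons \<open>s \<noteq> j\<close> cancel against the correction of the weight
  \<open>w (k, i, j)\<close>, so that only the scale of the new neuron remains.
\<close>

lemma layer_p_rescaled:
  assumes t0: "\<And>j. t 0 j = 0"
  shows "k \<in> {1..L} \<Longrightarrow> i \<in> {1..d k} \<Longrightarrow>
    layer_p d (rescaled d L t w) k i = Const (exp (t k i)) * layer_p d w k i"
proof (induction d w k i rule: layer_p.induct)
  case (1 d w i)
  then show ?case by simp
next
  case (2 d w i)
  then have "Const (rescaled d L t w (1, i, j)) = Const (exp (t 1 i)) * Const (w (1, i, j))"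
    if "j \<in> {1..d 0}" for j
    using that by (simp add: rescaled_def weight_indices_def t0 Const_mult mult.commute)
  then show ?case
    by (simp add: sum_distrib_left mult.assoc)
next
  case (3 d w k i)
  let ?v = "rescaled d L t w" and ?K = "Suc (Suc k)" and ?D = "{1..d (Suc k)}"
  have "Const (?v (?K, i, j)) * (\<Prod>s\<in>?D - {j}. layer_p d ?v (Suc k) s) =
      Const (exp (t ?K i)) * (Const (w (?K, i, j)) * (\<Prod>s\<in>?D - {j}. layer_p d w (Suc k) s))"
    if j: "j \<in> ?D" for j
  proof -
    have "(\<Prod>s\<in>?D - {j}. layer_p d ?v (Suc k) s) =
        (\<Prod>s\<in>?D - {j}. Const (exp (t (Suc k) s)) * layer_p d w (Suc k) s)"
      using "3.IH" "3.prems" j by (intro prod.cong) auto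
    also have "\<dots> = Const (exp (\<Sum>s\<in>?D - {j}. t (Suc k) s)) *
        (\<Prod>s\<in>?D - {j}. layer_p d w (Suc k) s)"
      by (simp add: prod.distrib Const_prod exp_sum)
    finally have P: "(\<Prod>s\<in>?D - {j}. layer_p d ?v (Suc k) s) =
        Const (exp (\<Sum>s\<in>?D - {j}. t (Suc k) s)) * (\<Prod>s\<in>?D - {j}. layer_p d w (Suc k) s)" .
    have "(\<Sum>s\<in>?D. t (Suc k) s) = t (Suc k) j + (\<Sum>s\<in>?D - {j}. t (Suc k) s)"
      using j by (simp add: sum.remove)
    then have "?v (?K, i, j) =
        w (?K, i, j) * exp (t ?K i - (\<Sum>s\<in>?D - {j}. t (Suc k) s))"
      using j "3.prems" by (simp add: rescaled_def weight_indices_def)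
    then have "?v (?K, i, j) * exp (\<Sum>s\<in>?D - {j}. t (Suc k) s) = exp (t ?K i) * w (?K, i, j)"
      by (simp add: exp_diff)
    then have "Const (?v (?K, i, j)) * Const (exp (\<Sum>s\<in>?D - {j}. t (Suc k) s)) =
        Const (exp (t ?K i)) * Const (w (?K, i, j))"
      by (simp only: Const_mult[symmetric])
    then show ?thesis by (simp only: P mult.assoc[symmetric])
  qed
  then show ?case
    by (simp add: sum_distrib_left del: prod.insert_remove)
qed

lemma layer_q_rescaled:
  assumes t0: "\<And>j. t 0 j = 0" and "k \<le> L"
  shows "layer_q d (rescaled d L t w) k =
    Const (exp (\<Sum>s=1..d (k - 1). t (k - 1) s)) * layer_q d w k"
proof (cases "k \<le> 1")
  case True
  then have "k - 1 = 0" by simp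
  then show ?thesis using True by (simp add: layer_q_def t0 Const_1)
next
  case False
  then have "(\<Prod>j=1..d (k - 1). layer_p d (rescaled d L t w) (k - 1) j) =
      (\<Prod>j=1..d (k - 1). Const (exp (t (k - 1) j)) * layer_p d w (k - 1) j)"
    using assms by (intro prod.cong layer_p_rescaled) auto
  then show ?thesis
    using False by (simp add: layer_q_def prod.distrib Const_prod exp_sum)
qed

lemma prod_layer_q_rescaled:
  assumes "\<And>j. t 0 j = 0" "\<And>k. k \<in> K \<Longrightarrow> k \<le> L"
  shows "(\<Prod>k\<in>K. layer_q d (rescaled d L t w) k) =
    Const (exp (\<Sum>k\<in>K. \<Sum>s=1..d (k - 1). t (k - 1) s)) * (\<Prod>k\<in>K. layer_q d w k)"
proof -
  have "finite K" using assms(2) finite_subset[of K "{..L}"] by auto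
  then show ?thesis
    using assms(2) by (simp add: layer_q_rescaled[where t = t, OF assms(1)] prod.distrib
        Const_prod exp_sum)
qed

text \<open>
  The two equations say that the factors picked up by the numerators and by the common denominator
  are 1.
\<close>

lemma rescaled_in_fiber:
  assumes "L \<ge> 1" and t0: "\<And>j. t 0 j = 0"
    and num: "\<And>i. i \<in> {1..d L} \<Longrightarrow>
      t L i + (\<Sum>k | k \<le> L - 1 \<and> k mod 2 = (L + 1) mod 2. \<Sum>s=1..d (k - 1). t (k - 1) s) = 0"
    and den: "(\<Sum>k | k \<le> L \<and> k mod 2 = L mod 2. \<Sum>s=1..d (k - 1). t (k - 1) s) = 0"
  shows "rescaled d L t w \<in> fiber d L w"
proof -
  let ?v = "rescaled d L t w"
  have "denom d L ?v = denom d L w"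
    unfolding denom_def
    by (subst prod_layer_q_rescaled[where t = t, OF t0]) (use den in \<open>auto simp: Const_1\<close>)
  moreover have "numer d L ?v i = numer d L w i" if i: "i \<in> {1..d L}" for i
  proof -
    let ?K = "{k. k \<le> L - 1 \<and> k mod 2 = (L + 1) mod 2}"
    let ?e = "\<Sum>k\<in>?K. \<Sum>s=1..d (k - 1). t (k - 1) s"
    have q: "(\<Prod>k\<in>?K. layer_q d ?v k) = Const (exp ?e) * (\<Prod>k\<in>?K. layer_q d w k)"
      by (rule prod_layer_q_rescaled[where t = t, OF t0]) auto
    have p: "layer_p d ?v L i = Const (exp (t L i)) * layer_p d w L i"
      using \<open>L \<ge> 1\<close> i by (intro layer_p_rescaled t0) auto
    have "numer d L ?v i = Const (exp (t L i) * exp ?e) * numer d L w i"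
      unfolding numer_def p q Const_mult by (simp only: ac_simps)
    also have "exp (t L i) * exp ?e = 1"
      using num[OF i] by (simp only: exp_add[symmetric] exp_zero)
    finally show ?thesis by (simp add: Const_1)
  qed
  moreover have "?v \<in> affine_space (weight_indices d L)"
    by (simp add: affine_space_def rescaled_def)
  ultimately show ?thesis
    by (auto simp: fiber_def parameter_map_def intro!: restrict_ext)
qed

section \<open>Recovering the scales from the weights\<close>

lemma poly_fun_prod:
  assumes "\<And>a. a \<in> A \<Longrightarrow> poly_fun I (f a)"
  shows "poly_fun I (\<lambda>x. \<Prod>a\<in>A. f a x)"
  using assms
  by (induction A rule: infinite_finite_induct) (auto intro: poly_fun.const poly_fun.mult)

text \<open>
  The scales as functions of the rescaled weights \<open>v\<close>, for fixed original weights \<open>w\<close>. The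
  product, which equals the scale \<open>M k\<close> of the whole layer divided by that of its first
  neuron, undoes the correction in the weight \<open>v (Suc k, i, 1)\<close>.
\<close>

fun recovered_scale :: "(nat \<Rightarrow> nat) \<Rightarrow> weights \<Rightarrow> nat \<Rightarrow> nat \<Rightarrow> weights \<Rightarrow> real" where
  "recovered_scale d w 0 i v = 1"
| "recovered_scale d w (Suc k) i v = inverse (w (Suc k, i, 1)) * v (Suc k, i, 1) *
     (\<Prod>s\<in>{1..d k} - {1}. recovered_scale d w k s v)"

lemma poly_fun_recovered_scale:
  assumes "\<And>l. l < k \<Longrightarrow> d l \<ge> 1" "k \<le> L" "i \<in> {1..d k}"
  shows "poly_fun (weight_indices d L) (recovered_scale d w k i)"
  using assms
proof (induction k arbitrary: i)
  case 0
  show ?case by (simp add: poly_fun.const)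
next
  case (Suc k)
  have "(Suc k, i, 1) \<in> weight_indices d L"
    using Suc.prems by (auto simp: weight_indices_def)
  moreover have "poly_fun (weight_indices d L) (recovered_scale d w k s)"
    if "s \<in> {1..d k} - {1}" for s
    using that Suc.prems by (intro Suc.IH) auto
  ultimately have "poly_fun (weight_indices d L) (\<lambda>v. inverse (w (Suc k, i, 1)) * v (Suc k, i, 1) *
      (\<Prod>s\<in>{1..d k} - {1}. recovered_scale d w k s v))"
    by (intro poly_fun.mult poly_fun.const poly_fun.coord poly_fun_prod)
  moreover have "recovered_scale d w (Suc k) i = (\<lambda>v. inverse (w (Suc k, i, 1)) * v (Suc k, i, 1) *
      (\<Prod>s\<in>{1..d k} - {1}. recovered_scale d w k s v))"
    by (rule ext) (rule recovered_scale.simps)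
  ultimately show ?case by (simp only:)
qed

lemma recovered_scale_rescaled:
  assumes t0: "\<And>j. t 0 j = 0"
    and w: "\<And>v. v \<in> weight_indices d L \<Longrightarrow> w v \<noteq> 0"
    and "\<And>l. l < k \<Longrightarrow> d l \<ge> 1" "k \<le> L" "i \<in> {1..d k}"
  shows "recovered_scale d w k i (rescaled d L t w) = exp (t k i)"
  using assms(3-)
proof (induction k arbitrary: i)
  case 0
  show ?case by (simp add: t0)
next
  case (Suc k)
  have 1: "1 \<in> {1..d k}" using Suc.prems(1)[of k] by simp
  have K: "(Suc k, i, 1) \<in> weight_indices d L"
    using Suc.prems 1 by (auto simp: weight_indices_def)
  have "(\<Prod>s\<in>{1..d k} - {1}. recovered_scale d w k s (rescaled d L t w)) =
      (\<Prod>s\<in>{1..d k} - {1}. exp (t k s))"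
    using Suc.prems by (intro prod.cong Suc.IH) auto
  also have "\<dots> = exp (\<Sum>s\<in>{1..d k} - {1}. t k s)"
    by (simp add: exp_sum)
  finally have P: "(\<Prod>s\<in>{1..d k} - {1}. recovered_scale d w k s (rescaled d L t w)) =
      exp (\<Sum>s\<in>{1..d k} - {1}. t k s)" .
  have "(\<Sum>s\<in>{1..d k}. t k s) = t k 1 + (\<Sum>s\<in>{1..d k} - {1}. t k s)"
    using 1 by (simp only: sum.remove finite_atLeastAtMost)
  then have "rescaled d L t w (Suc k, i, 1) =
      w (Suc k, i, 1) * exp (t (Suc k) i - (\<Sum>s\<in>{1..d k} - {1}. t k s))"
    using K by (simp add: rescaled_def)
  then show ?case
    using w[OF K] by (simp only: recovered_scale.simps P exp_diff) simp
qed


section \<open>The dimension of the generic fiber\<close>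

lemma fiber_subset: "fiber d L w \<subseteq> affine_space (weight_indices d L)"
  by (auto simp: fiber_def)

lemma for_generic_all_nonzero:
  assumes "finite I"
    and "\<And>x. x \<in> affine_space I \<Longrightarrow> (\<And>v. v \<in> I \<Longrightarrow> x v \<noteq> 0) \<Longrightarrow> P x"
  shows "for_generic I P"
proof -
  define U where "U = {x \<in> affine_space I. \<forall>v\<in>I. x v \<noteq> 0}"
  have "affine_space I - U = zero_locus I {\<lambda>x. \<Prod>v\<in>I. x v}"
    using \<open>finite I\<close> by (auto simp: U_def zero_locus_def)
  moreover have "poly_fun I (\<lambda>x. \<Prod>v\<in>I. x v)"
    by (intro poly_fun_prod poly_fun.coord)
  ultimately have "openin (zariski I) U"
    by (auto simp: openin_zariski algebraic_set_def U_def)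
  moreover have "(\<lambda>v\<in>I. 1) \<in> U"
    by (simp add: U_def affine_space_def)
  moreover have "\<forall>x\<in>U. P x"
    using assms(2) by (auto simp: U_def)
  ultimately show ?thesis
    unfolding for_generic_def by blast
qed

text \<open>
  The scale of the first neuron of the last hidden layer is determined by the others through the
  equation for the denominator. That layer contributes to the denominator but not to the
  numerators, so the equations can be solved independently of each other.
\<close>

definition free_neurons :: "(nat \<Rightarrow> nat) \<Rightarrow> nat \<Rightarrow> (nat \<times> nat) set" where
  "free_neurons d L = (SIGMA k:{1..L - 1}. {1..d k}) - {(L - 1, 1)}"

lemma card_free_neurons:
  assumes "L \<ge> 2" "d (L - 1) \<ge> 1"
  shows "real (card (free_neurons d L)) = (\<Sum>i=1..L-1. real (d i)) - 1"
proof -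
  let ?H = "SIGMA k:{1..L - 1}. {1..d k}"
  have mem: "(L - 1, 1) \<in> ?H" using assms by auto
  have "finite ?H" by simp
  then have "card ?H \<ge> 1" using mem by (metis One_nat_def Suc_leI card_gt_0_iff empty_iff)
  moreover have "card ?H = (\<Sum>i=1..L-1. d i)" by simp
  ultimately show ?thesis
    using mem by (simp add: free_neurons_def card_Diff_singleton of_nat_diff)
qed

text \<open>
  The logarithm of the scale of a layer below the last hidden one. Layer 0 is excluded because
  \<open>u\<close> may be nonzero there, whereas the inputs are not rescaled.
\<close>

definition layer_sum :: "(nat \<Rightarrow> nat) \<Rightarrow> (nat \<times> nat \<Rightarrow> real) \<Rightarrow> nat \<Rightarrow> real" where
  "layer_sum d u k = (if k = 0 then 0 else \<Sum>s=1..d k. u (k, s))"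

text \<open>
  The second and third cases are the solutions of the equations in \<open>rescaled_in_fiber\<close> for the
  output scale and for the scale of the neuron \<open>(L - 1, 1)\<close>.
\<close>

definition log_scales ::
    "(nat \<Rightarrow> nat) \<Rightarrow> nat \<Rightarrow> (nat \<times> nat \<Rightarrow> real) \<Rightarrow> nat \<Rightarrow> nat \<Rightarrow> real" where
  "log_scales d L u k i =
     (if k = 0 then 0
      else if k = L then
        - (\<Sum>l | l \<le> L - 1 \<and> l mod 2 = (L + 1) mod 2. layer_sum d u (l - 1))
      else if (k, i) = (L - 1, 1) then
        - (\<Sum>s=2..d (L - 1). u (L - 1, s))
        - (\<Sum>l | l \<le> L - 2 \<and> l mod 2 = L mod 2. layer_sum d u (l - 1))
      else u (k, i))"

lemma line_entire_log_scales: "line_entire (\<lambda>u. log_scales d L u k i)"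
  unfolding log_scales_def layer_sum_def
  by (intro line_entire_if line_entire_const line_entire_sum line_entire_coord line_entire_minus
      line_entire_diff)

lemma sum_log_scales_inner:
  assumes "k + 1 < L"
  shows "(\<Sum>s=1..d k. log_scales d L u k s) = layer_sum d u k"
  using assms by (auto simp: log_scales_def layer_sum_def intro!: sum.cong sum.neutral)

lemma sum_log_scales_last:
  assumes "L \<ge> 2" "d (L - 1) \<ge> 1"
  shows "(\<Sum>s=1..d (L - 1). log_scales d L u (L - 1) s) =
    - (\<Sum>l | l \<le> L - 2 \<and> l mod 2 = L mod 2. layer_sum d u (l - 1))"
proof -
  have "(\<Sum>s=1..d (L - 1). log_scales d L u (L - 1) s) =
      log_scales d L u (L - 1) 1 + (\<Sum>s=2..d (L - 1). log_scales d L u (L - 1) s)"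
    using assms(2) by (simp add: sum.atLeast_Suc_atMost numeral_2_eq_2)
  also have "(\<Sum>s=2..d (L - 1). log_scales d L u (L - 1) s) = (\<Sum>s=2..d (L - 1). u (L - 1, s))"
    using assms(1) by (intro sum.cong) (auto simp: log_scales_def)
  also have "log_scales d L u (L - 1) 1 = - (\<Sum>s=2..d (L - 1). u (L - 1, s))
      - (\<Sum>l | l \<le> L - 2 \<and> l mod 2 = L mod 2. layer_sum d u (l - 1))"
    using assms(1) by (simp add: log_scales_def)
  finally show ?thesis by simp
qed

lemma rescaled_log_scales_in_fiber:
  assumes "L \<ge> 2" "d (L - 1) \<ge> 1"
  shows "rescaled d L (log_scales d L u) w \<in> fiber d L w"
proof (rule rescaled_in_fiber)
  let ?t = "log_scales d L u"
  show "L \<ge> 1" using assms(1) by simp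
  show "?t 0 j = 0" for j by (simp add: log_scales_def)
  show "?t L i + (\<Sum>k | k \<le> L - 1 \<and> k mod 2 = (L + 1) mod 2.
      \<Sum>s=1..d (k - 1). ?t (k - 1) s) = 0" for i
  proof -
    have "(\<Sum>k | k \<le> L - 1 \<and> k mod 2 = (L + 1) mod 2. \<Sum>s=1..d (k - 1). ?t (k - 1) s) =
        (\<Sum>k | k \<le> L - 1 \<and> k mod 2 = (L + 1) mod 2. layer_sum d u (k - 1))"
      using assms(1) by (intro sum.cong refl sum_log_scales_inner) auto
    then show ?thesis using assms(1) by (simp add: log_scales_def)
  qed
  show "(\<Sum>k | k \<le> L \<and> k mod 2 = L mod 2. \<Sum>s=1..d (k - 1). ?t (k - 1) s) = 0"
  proof -
    let ?K = "{k. k \<le> L - 2 \<and> k mod 2 = L mod 2}"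
    have "{k. k \<le> L \<and> k mod 2 = L mod 2} = insert L ?K"
    proof (intro equalityI subsetI)
      fix k assume k: "k \<in> {k. k \<le> L \<and> k mod 2 = L mod 2}"
      then have "k \<noteq> L - 1" using assms(1) by (auto simp: mod2_eq_if split: if_splits)
      then show "k \<in> insert L ?K" using k by auto
    qed auto
    moreover have "L \<notin> ?K" using assms(1) by auto
    moreover have "(\<Sum>k\<in>?K. \<Sum>s=1..d (k - 1). ?t (k - 1) s) = (\<Sum>k\<in>?K. layer_sum d u (k - 1))"
      using assms(1) by (intro sum.cong refl sum_log_scales_inner) auto
    (* The index \<open>k = L\<close> contributes the last hidden layer, which cancels all other terms. *)
    ultimately show ?thesis
      using sum_log_scales_last[of L d u] assms by simp
  qed
qed

text \<open>
  Subtracting 1 from a recovered scale gives a polynomial that is zero exactly when the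
  logarithm of that scale is.
\<close>

lemma fiber_dim_ge_card_free_neurons:
  assumes "L \<ge> 2" and d: "\<And>l. l < L \<Longrightarrow> d l \<ge> 1"
    and w: "\<And>v. v \<in> weight_indices d L \<Longrightarrow> w v \<noteq> 0"
  shows "ereal (real (card (free_neurons d L))) \<le> fiber_dim d L w"
  unfolding fiber_dim_def
proof (rule krull_dim_ge_card)
  let ?\<phi> = "\<lambda>u. rescaled d L (log_scales d L u) w"
  let ?g = "\<lambda>(k, i) v. recovered_scale d w k i v + (- 1)"
  show "finite (free_neurons d L)" by (simp add: free_neurons_def)
  show "fiber d L w \<subseteq> affine_space (weight_indices d L)" by (rule fiber_subset)
  show "?\<phi> u \<in> fiber d L w" for u
    using assms by (intro rescaled_log_scales_in_fiber) auto
  show "line_entire (\<lambda>u. ?\<phi> u v)" if "v \<in> weight_indices d L" for v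
    using that unfolding rescaled_def
    by (cases v) (auto intro!: line_entire_mult line_entire_const line_entire_exp line_entire_add
        line_entire_diff line_entire_sum line_entire_log_scales)
  fix h assume h: "h \<in> free_neurons d L"
  obtain k i where [simp]: "h = (k, i)" by (cases h)
  have ki: "k \<in> {1..L - 1}" "i \<in> {1..d k}" "(k, i) \<noteq> (L - 1, 1)"
    using h by (auto simp: free_neurons_def)
  have "poly_fun (weight_indices d L) (recovered_scale d w k i)"
    using ki d by (intro poly_fun_recovered_scale) auto
  from poly_fun.add[OF this poly_fun.const[of _ "- 1"]]
  show "poly_fun (weight_indices d L) (?g h)" by simp
  show "?g h (?\<phi> u) = 0 \<longleftrightarrow> u h = 0" for u
  proof -
    have "recovered_scale d w k i (?\<phi> u) = exp (log_scales d L u k i)"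
      using ki d w by (intro recovered_scale_rescaled) (auto simp: log_scales_def)
    also have "log_scales d L u k i = u (k, i)"
      using ki by (auto simp: log_scales_def)
    finally show ?thesis by simp
  qed
qed

theorem lemma6p1:
  fixes L :: nat and d :: "nat \<Rightarrow> nat"
  assumes "L \<ge> 1"
    and "\<forall>i<L. d i \<ge> 2"
  shows "for_generic (weight_indices d L)
           (\<lambda>w. fiber_dim d L w \<ge> ereal ((\<Sum>i=1..L-1. real (d i)) - 1))"
proof (rule for_generic_all_nonzero)
  show "finite (weight_indices d L)" by (simp add: weight_indices_Sigma)
  have d: "d l \<ge> 1" if "l < L" for l using assms(2) that by force
  fix w assume w: "w \<in> affine_space (weight_indices d L)"
    "\<And>v. v \<in> weight_indices d L \<Longrightarrow> w v \<noteq> 0"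
  show "fiber_dim d L w \<ge> ereal ((\<Sum>i=1..L-1. real (d i)) - 1)"
  proof (cases "L = 1")
    case True
    (* There are no hidden neurons; the bound is -1, and the fiber is nonempty. *)
    have "ereal (real (card ({} :: nat set))) \<le> fiber_dim d L w"
      unfolding fiber_dim_def
      by (rule krull_dim_ge_card[where \<phi> = "\<lambda>_. w" and g = "\<lambda>_ _. 0"])
        (use w in \<open>auto simp: fiber_def intro: line_entire_const\<close>)
    then have "0 \<le> fiber_dim d L w" by (simp add: zero_ereal_def)
    moreover have "ereal ((\<Sum>i=1..L-1. real (d i)) - 1) \<le> 0" using True by simp
    ultimately show ?thesis by (rule order_trans[rotated])
  next
    case False
    then have "L \<ge> 2" using assms(1) by simp
    then have "(\<Sum>i=1..L-1. real (d i)) - 1 = real (card (free_neurons d L))"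
      using d by (simp add: card_free_neurons)
    then show ?thesis
      using fiber_dim_ge_card_free_neurons[OF \<open>L \<ge> 2\<close> d w(2)] by simp
  qed
qed

end
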